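(* For each station $n=1,\ldots,N$, let $v^{(n-1)}=[v_0^{(n-1)},\ldots,v_C^{(n-1)}]\in\mathbb{R}^{C+1}$ be the steady state distribution of the vehicle load on departure from station $n-1$, let $g^{(n)}=[g_0^{(n)},\ldots,g_C^{(n)}]\in\mathbb{R}^{C+1}$ be the steady state distribution of the vehicle load at station $n$ after alighting (before boarding), and let $s^{(n)}=[s_0^{(n)},\ldots,s_C^{(n)}]\in\mathbb{R}^{C+1}$ be the steady state distribution of the available space at station $n$ after alighting. Then $$g^{(n)}=v^{(n-1)}A^{(n)},\qquad s_k^{(n)}=g_{C-k}^{(n)}\quad\text{for all }k=0,1,\ldots,C,$$ where $A^{(n)}$ is the $(C+1)\times(C+1)$ matrix with entries, for $i,j=0,\ldots,C$, $$a_{ij}^{(n)}=\begin{cases}\binom{i}{j}(1-\alpha^{(n)})^{j}(\alpha^{(n)})^{i-j}, & 0\le j\le i\le C,\\ 0,&\text{otherwise,}\end{cases}$$ and $a_{ij}^{(n)}$ is the probability that $j$ passengers remain on board after alighting, conditional on $i$ passengers being on board before alighting.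
   Context: Single transit route with stations $1,\ldots,N$ visited in order by vehicles $l=1,2,\ldots$, each of integer capacity $C\ge1$. $V^{(n,l)}\in\{0,\ldots,C\}$ is the load of vehicle $l$ when it departs station $n$ (equivalently, when it arrives at station $n+1$); $V^{(0,l)}=0$. When vehicle $l$ arrives at station $n$, each of the $V^{(n-1,l)}$ onboard passengers alights independently with probability $\alpha^{(n)}\in[0,1]$, so conditional on $V^{(n-1,l)}$ the number alighting is binomial with parameters $V^{(n-1,l)}$ and $\alpha^{(n)}$. $G^{(n,l)}$ is the number of passengers remaining on board after alighting, and $S^{(n,l)}$ is the number of available spaces after alighting, so $G^{(n,l)}=C-S^{(n,l)}$. Put $v_k^{(n,l)}=\mathbb{P}(V^{(n,l)}=k)$, $g_k^{(n,l)}=\mathbb{P}(G^{(n,l)}=k)$, $s_k^{(n,l)}=\mathbb{P}(S^{(n,l)}=k)$. The steady state probabilities are the limits $v_k^{(n)}=\lim_{l\to\infty}v_k^{(n,l)}$, $g_k^{(n)}=\lim_{l\to\infty}g_k^{(n,l)}$, $s_k^{(n)}=\lim_{l\to\infty}s_k^{(n,l)}$, which are assumed to exist. Distributions are row vectors indexed from $0$ to $C$. *)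

theory Defs
  imports "HOL-Probability.Probability" "Jordan_Normal_Form.Matrix"
begin

unbundle no vec_syntax

text \<open>
  \<open>V n l\<close> is the load of vehicle \<open>l\<close> on departure from station \<open>n\<close>; it is constrained only by
  the capacity, so boarding is arbitrary. Passengers on board vehicle \<open>l\<close> on arrival at station
  \<open>n\<close> are numbered \<open>p < V (n - 1) l \<omega>\<close>, and \<open>alights n l p \<omega>\<close> says that passenger \<open>p\<close> gets off
  there. Conditionally on the arriving load being \<open>i\<close> (for \<open>i\<close> of positive probability), the
  indicators of passengers \<open>p < i\<close> are independent, each true with probability \<open>\<alpha> n\<close>; nothing is
  assumed about their joint law across stations or vehicles. Vehicles are numbered from 1.
\<close>

locale transit_route = prob_space M
  for M :: "'w measure" +
  fixes N C :: nat
    and \<alpha> :: "nat \<Rightarrow> real"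
    and V :: "nat \<Rightarrow> nat \<Rightarrow> 'w \<Rightarrow> nat"
    and alights :: "nat \<Rightarrow> nat \<Rightarrow> nat \<Rightarrow> 'w \<Rightarrow> bool"
  assumes capacity_pos: "1 \<le> C"
    and alpha_range: "n \<in> {1..N} \<Longrightarrow> \<alpha> n \<in> {0..1}"
    and load_measurable: "n \<le> N \<Longrightarrow> 1 \<le> l \<Longrightarrow> V n l \<in> M \<rightarrow>\<^sub>M count_space UNIV"
    and load_le: "n \<le> N \<Longrightarrow> 1 \<le> l \<Longrightarrow> \<omega> \<in> space M \<Longrightarrow> V n l \<omega> \<le> C"
    and load_start: "1 \<le> l \<Longrightarrow> \<omega> \<in> space M \<Longrightarrow> V 0 l \<omega> = 0"
    and alights_measurable:
      "n \<in> {1..N} \<Longrightarrow> 1 \<le> l \<Longrightarrow> p < C \<Longrightarrow> alights n l p \<in> M \<rightarrow>\<^sub>M count_space UNIV"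
    and alights_prob:
      "n \<in> {1..N} \<Longrightarrow> 1 \<le> l \<Longrightarrow> \<P>(\<omega> in M. V (n - 1) l \<omega> = i) > 0 \<Longrightarrow> p < i \<Longrightarrow>
        \<P>(\<omega> in M. alights n l p \<omega> \<bar> V (n - 1) l \<omega> = i) = \<alpha> n"
    and alights_indep:
      "n \<in> {1..N} \<Longrightarrow> 1 \<le> l \<Longrightarrow> \<P>(\<omega> in M. V (n - 1) l \<omega> = i) > 0 \<Longrightarrow>
        prob_space.indep_vars (uniform_measure M {\<omega> \<in> space M. V (n - 1) l \<omega> = i})
          (\<lambda>_. count_space UNIV) (alights n l) {..<i}"

definition remaining ::
    "(nat \<Rightarrow> nat \<Rightarrow> 'w \<Rightarrow> nat) \<Rightarrow> (nat \<Rightarrow> nat \<Rightarrow> nat \<Rightarrow> 'w \<Rightarrow> bool) \<Rightarrow> nat \<Rightarrow> nat \<Rightarrow> 'w \<Rightarrow> nat" where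
  "remaining V alights n l \<omega> = card {p. p < V (n - 1) l \<omega> \<and> \<not> alights n l p \<omega>}"

definition available ::
    "nat \<Rightarrow> (nat \<Rightarrow> nat \<Rightarrow> 'w \<Rightarrow> nat) \<Rightarrow> (nat \<Rightarrow> nat \<Rightarrow> nat \<Rightarrow> 'w \<Rightarrow> bool) \<Rightarrow> nat \<Rightarrow> nat \<Rightarrow> 'w \<Rightarrow> nat" where
  "available C V alights n l \<omega> = C - remaining V alights n l \<omega>"

text \<open>
  For a sequence \<open>X l\<close> of random variables indexed by vehicles. The value at the unused index
  \<open>l = 0\<close> does not affect the limits.
\<close>

definition has_steady_state :: "'w measure \<Rightarrow> nat \<Rightarrow> (nat \<Rightarrow> 'w \<Rightarrow> nat) \<Rightarrow> bool" where
  "has_steady_state M C X \<longleftrightarrow> (\<forall>k\<le>C. convergent (\<lambda>l. \<P>(\<omega> in M. X l \<omega> = k)))"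

definition steady_state :: "'w measure \<Rightarrow> nat \<Rightarrow> (nat \<Rightarrow> 'w \<Rightarrow> nat) \<Rightarrow> real vec" where
  "steady_state M C X = vec (C + 1) (\<lambda>k. lim (\<lambda>l. \<P>(\<omega> in M. X l \<omega> = k)))"

definition alighting_matrix :: "nat \<Rightarrow> real \<Rightarrow> real mat" where
  "alighting_matrix C a = mat (C + 1) (C + 1)
    (\<lambda>(i, j). if j \<le> i then real (i choose j) * (1 - a) ^ j * a ^ (i - j) else 0)"

end

theory Submission
  imports Defs
begin

text \<open>
  Conditionally on an arriving load \<open>i\<close>, the passengers that stay form a set \<open>S \<subseteq> {..<i}\<close> whose
  law is a product, so every set of size \<open>j\<close> has probability \<open>(1 - \<alpha>) ^ j * \<alpha> ^ (i - j)\<close> and the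
  number of remaining passengers is binomial. The law of total probability over the arriving load
  then gives \<open>g = v A\<close> for each single vehicle, and this finite linear identity passes to the limit.
\<close>

text \<open>Sorting outcomes by the exact set \<open>S\<close> of false indices turns the event into
  a finite union, over \<open>S\<close> of size \<open>j\<close>, of finite conjunctions of
  measurable conditions.\<close>

lemma (in prob_space) measurable_card_false_Collect:
  assumes "finite I" and [measurable]: "\<And>p. p \<in> I \<Longrightarrow> X p \<in> M \<rightarrow>\<^sub>M count_space UNIV"
  shows "{\<omega> \<in> space M. card {p \<in> I. \<not> X p \<omega>} = j} \<in> events"
proof -
  have "{\<omega> \<in> space M. card {p \<in> I. \<not> X p \<omega>} = j} =
      (\<Union>S \<in> {S. S \<subseteq> I \<and> card S = j}. {\<omega> \<in> space M. \<forall>p\<in>I. X p \<omega> = (p \<notin> S)})"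
    (is "?L = ?R")
  proof
    show "?L \<subseteq> ?R"
    proof
      fix \<omega> assume "\<omega> \<in> ?L"
      then show "\<omega> \<in> ?R"
        by (intro UN_I[of "{p \<in> I. \<not> X p \<omega>}"]) auto
    qed
    show "?R \<subseteq> ?L"
    proof
      fix \<omega> assume "\<omega> \<in> ?R"
      then obtain S where S: "S \<subseteq> I" "card S = j" "\<omega> \<in> space M" "\<forall>p\<in>I. X p \<omega> = (p \<notin> S)"
        by auto
      then have "{p \<in> I. \<not> X p \<omega>} = S" by auto
      with S show "\<omega> \<in> ?L" by simp
    qed
  qed
  moreover have "?R \<in> events"
    using \<open>finite I\<close> by (intro sets.finite_UN sets.sets_Collect_finite_All) auto
  ultimately show ?thesis by simp
qed

text \<open>By independence, a prescribed set \<open>S\<close> of \<open>j\<close> false indices has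
  a probability that depends only on \<open>j\<close>. The events for distinct \<open>S\<close> are
  disjoint, and there are \<open>card I choose j\<close> of them. In the application, false means
  that the passenger stays on board.\<close>

lemma (in prob_space) prob_card_false_binomial:
  assumes indep: "indep_vars (\<lambda>_. count_space UNIV) X I" and fin: "finite I"
    and prob: "\<And>p. p \<in> I \<Longrightarrow> \<P>(\<omega> in M. X p \<omega>) = a"
  shows "\<P>(\<omega> in M. card {p \<in> I. \<not> X p \<omega>} = j) =
    real (card I choose j) * (1 - a) ^ j * a ^ (card I - j)"
proof -
  define E where "E S = {\<omega> \<in> space M. {p \<in> I. \<not> X p \<omega>} = S}" for S
  define \<S> where "\<S> = {S. S \<subseteq> I \<and> card S = j}"
  have X [measurable]: "X p \<in> M \<rightarrow>\<^sub>M count_space UNIV" if "p \<in> I" for p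
    using indep that by (auto simp: indep_vars_def)
  have E_eq: "E S = {\<omega> \<in> space M. \<forall>p\<in>I. X p \<omega> = (p \<notin> S)}" if "S \<subseteq> I" for S
    using that by (auto simp: E_def)
  have E_events: "E S \<in> events" if "S \<subseteq> I" for S
    unfolding E_eq[OF that] using fin by (intro sets.sets_Collect_finite_All) auto
  have prob_not: "\<P>(\<omega> in M. \<not> X p \<omega>) = 1 - a" if "p \<in> I" for p
    using prob_neg[of "X p"] prob[OF that] that by simp
  have prob_E: "prob (E S) = (1 - a) ^ j * a ^ (card I - j)" if S: "S \<in> \<S>" for S
  proof -
    have SI: "S \<subseteq> I" and cS: "card S = j" using S by (auto simp: \<S>_def)
    have finS: "finite S" using SI fin by (rule finite_subset)
    \<comment> \<open>Here \<open>{p \<notin> S}\<close> is the singleton of a truth value, not a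
      comprehension: the factor for \<open>p\<close> is the probability that \<open>X p\<close>
      takes the value prescribed by \<open>S\<close>.\<close>
    have "prob (E S) = (\<Prod>p\<in>I. prob (X p -` {p \<notin> S} \<inter> space M))"
    \<comment> \<open>The product rule for independent variables needs a nonempty index set, and an
      intersection over the empty set would be \<open>UNIV\<close> instead of
      \<open>space M\<close>. For empty \<open>I\<close> both sides are 1.\<close>
    proof (cases "I = {}")
      case True
      with SI show ?thesis by (simp add: E_def prob_space)
    next
      case False
      have "E S = (\<Inter>p\<in>I. X p -` {p \<notin> S} \<inter> space M)"
        unfolding E_eq[OF SI] using False by auto
      then show ?thesis using indep_varsD_finite[OF indep False fin] by simp
    qed
    also have "\<dots> = (\<Prod>p\<in>I. if p \<in> S then 1 - a else a)"
    proof (rule prod.cong)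
      fix p assume p: "p \<in> I"
      have "X p -` {p \<notin> S} \<inter> space M = {\<omega> \<in> space M. if p \<in> S then \<not> X p \<omega> else X p \<omega>}"
        by auto
      then show "prob (X p -` {p \<notin> S} \<inter> space M) = (if p \<in> S then 1 - a else a)"
        using prob[OF p] prob_not[OF p] by simp
    qed simp
    also have "\<dots> = (1 - a) ^ card S * a ^ card (I - S)"
    proof -
      have "I \<inter> {p. p \<in> S} = S" "I \<inter> - {p. p \<in> S} = I - S" using SI by auto
      then show ?thesis using fin by (simp add: prod.If_cases)
    qed
    also have "card (I - S) = card I - j"
      using card_Diff_subset[OF finS SI] cS by simp
    finally show ?thesis using cS by simp
  qed
  have "{\<omega> \<in> space M. card {p \<in> I. \<not> X p \<omega>} = j} = (\<Union>S\<in>\<S>. E S)"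
    by (auto simp: E_def \<S>_def)
  also have "prob \<dots> = (\<Sum>S\<in>\<S>. prob (E S))"
  proof (rule finite_measure_finite_Union)
    show "finite \<S>" using fin by (simp add: \<S>_def)
    show "E ` \<S> \<subseteq> events" using E_events by (auto simp: \<S>_def)
    show "disjoint_family_on E \<S>" by (auto simp: disjoint_family_on_def E_def)
  qed
  also have "\<dots> = real (card \<S>) * ((1 - a) ^ j * a ^ (card I - j))"
    using prob_E by simp
  also have "card \<S> = card I choose j"
    using n_subsets[OF fin] by (simp add: \<S>_def)
  finally show ?thesis by simp
qed

context transit_route
begin

lemma previous_load_measurable:
  assumes "n \<in> {1..N}" "1 \<le> l"
  shows "V (n - 1) l \<in> M \<rightarrow>\<^sub>M count_space UNIV"
  using assms by (intro load_measurable) auto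

lemma previous_load_le:
  assumes "n \<in> {1..N}" "1 \<le> l" "\<omega> \<in> space M"
  shows "V (n - 1) l \<omega> \<le> C"
  using assms by (intro load_le) auto

lemma remaining_le:
  assumes "n \<in> {1..N}" "1 \<le> l" "\<omega> \<in> space M"
  shows "remaining V alights n l \<omega> \<le> C"
proof -
  have "remaining V alights n l \<omega> \<le> card {..<V (n - 1) l \<omega>}"
    unfolding remaining_def by (intro card_mono) auto
  with previous_load_le[OF assms] show ?thesis by simp
qed

text \<open>Fixing the load at \<open>i\<close> replaces the random range of passengers by
  \<open>{..<i}\<close>, and \<open>i \<le> C\<close> keeps all of them among the passengers whose
  indicators are assumed measurable.\<close>

lemma remaining_and_load_event:
  assumes n: "n \<in> {1..N}" and l: "1 \<le> l" and i: "i \<le> C"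
  shows "{\<omega> \<in> space M. remaining V alights n l \<omega> = j \<and> V (n - 1) l \<omega> = i} \<in> events"
proof -
  note [measurable] = previous_load_measurable[OF n l]
  have "{\<omega> \<in> space M. card {p \<in> {..<i}. \<not> alights n l p \<omega>} = j} \<in> events"
    using alights_measurable[OF n l] i by (intro measurable_card_false_Collect) auto
  moreover have "{\<omega> \<in> space M. V (n - 1) l \<omega> = i} \<in> events" by measurable
  moreover have "{\<omega> \<in> space M. remaining V alights n l \<omega> = j \<and> V (n - 1) l \<omega> = i} =
      {\<omega> \<in> space M. card {p \<in> {..<i}. \<not> alights n l p \<omega>} = j} \<inter>
      {\<omega> \<in> space M. V (n - 1) l \<omega> = i}"
    by (auto simp: remaining_def)
  ultimately show ?thesis by (simp only: sets.Int)
qed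

text \<open>Conditioning on the load is done by changing the measure: since the event has positive
  probability, \<open>U\<close> is a probability measure, and under it the first \<open>i\<close>
  indicators satisfy the hypotheses of the binomial count.\<close>

lemma cond_prob_remaining:
  assumes n: "n \<in> {1..N}" and l: "1 \<le> l" and i: "i \<le> C" and j: "j \<le> C"
    and pos: "\<P>(\<omega> in M. V (n - 1) l \<omega> = i) > 0"
  shows "\<P>(\<omega> in M. remaining V alights n l \<omega> = j \<bar> V (n - 1) l \<omega> = i) =
    alighting_matrix C (\<alpha> n) $$ (i, j)"
proof -
  define B where "B = {\<omega> \<in> space M. V (n - 1) l \<omega> = i}"
  define U where "U = uniform_measure M B"
  note [measurable] = previous_load_measurable[OF n l]
  have al [measurable]: "alights n l p \<in> M \<rightarrow>\<^sub>M count_space UNIV" if "p < i" for p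
    using that i by (intro alights_measurable[OF n l]) simp
  have U_eq: "\<P>(\<omega> in U. P \<omega>) = \<P>(\<omega> in M. P \<omega> \<bar> V (n - 1) l \<omega> = i)"
    if "Measurable.pred M P" for P
    unfolding U_def B_def by (rule measure_uniform_measure_eq_cond_prob) (use that in measurable)
  interpret U: prob_space U
    unfolding U_def
    by (rule prob_space_uniform_measure) (use pos in \<open>auto simp: B_def emeasure_eq_measure\<close>)
  have "U.indep_vars (\<lambda>_. count_space UNIV) (alights n l) {..<i}"
    unfolding U_def B_def by (rule alights_indep[OF n l pos])
  moreover have "\<P>(\<omega> in U. alights n l p \<omega>) = \<alpha> n" if "p \<in> {..<i}" for p
    using U_eq[of "alights n l p"] alights_prob[OF n l pos] al that by simp
  ultimately have "\<P>(\<omega> in U. card {p \<in> {..<i}. \<not> alights n l p \<omega>} = j) =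
      real (i choose j) * (1 - \<alpha> n) ^ j * \<alpha> n ^ (i - j)"
    using U.prob_card_false_binomial[of "alights n l" "{..<i}" "\<alpha> n" j] by simp
  also have "\<dots> = alighting_matrix C (\<alpha> n) $$ (i, j)"
    using i j by (simp add: alighting_matrix_def)
  finally have "\<P>(\<omega> in M. card {p \<in> {..<i}. \<not> alights n l p \<omega>} = j \<bar> V (n - 1) l \<omega> = i) =
      alighting_matrix C (\<alpha> n) $$ (i, j)"
    using U_eq[of "\<lambda>\<omega>. card {p \<in> {..<i}. \<not> alights n l p \<omega>} = j"] al
    by (simp add: pred_def measurable_card_false_Collect)
  \<comment> \<open>The two counts need only agree where the load is \<open>i\<close>, because
    \<open>cond_prob\<close> is a quotient whose numerator already includes that condition.\<close>
  moreover have "{\<omega> \<in> space M. remaining V alights n l \<omega> = j \<and> V (n - 1) l \<omega> = i} =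
      {\<omega> \<in> space M. card {p \<in> {..<i}. \<not> alights n l p \<omega>} = j \<and> V (n - 1) l \<omega> = i}"
    by (auto simp: remaining_def)
  ultimately show ?thesis by (simp add: cond_prob_def)
qed

text \<open>The capacity bound makes the finitely many loads \<open>i \<le> C\<close> exhaust the
  space, so the event splits into the disjoint pieces \<open>?F i\<close>.\<close>

lemma prob_remaining:
  assumes n: "n \<in> {1..N}" and l: "1 \<le> l" and j: "j \<le> C"
  shows "\<P>(\<omega> in M. remaining V alights n l \<omega> = j) =
    (\<Sum>i\<le>C. \<P>(\<omega> in M. V (n - 1) l \<omega> = i) * alighting_matrix C (\<alpha> n) $$ (i, j))"
proof -
  note [measurable] = previous_load_measurable[OF n l]
  let ?F = "\<lambda>i. {\<omega> \<in> space M. remaining V alights n l \<omega> = j \<and> V (n - 1) l \<omega> = i}"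
  have "{\<omega> \<in> space M. remaining V alights n l \<omega> = j} = (\<Union>i\<le>C. ?F i)"
    using previous_load_le[OF n l] by auto
  then have "\<P>(\<omega> in M. remaining V alights n l \<omega> = j) = prob (\<Union>i\<le>C. ?F i)"
    by (simp only:)
  also have "\<dots> = (\<Sum>i\<le>C. prob (?F i))"
    by (rule finite_measure_finite_Union)
      (use remaining_and_load_event[OF n l] in \<open>auto simp: disjoint_family_on_def\<close>)
  also have "\<dots> = (\<Sum>i\<le>C. \<P>(\<omega> in M. V (n - 1) l \<omega> = i) * alighting_matrix C (\<alpha> n) $$ (i, j))"
  proof (rule sum.cong)
    fix i assume "i \<in> {..C}"
    then have i: "i \<le> C" by simp
    show "prob (?F i) = \<P>(\<omega> in M. V (n - 1) l \<omega> = i) * alighting_matrix C (\<alpha> n) $$ (i, j)"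
    proof (cases "\<P>(\<omega> in M. V (n - 1) l \<omega> = i) > 0")
      case True
      with cond_prob_remaining[OF n l i j True] show ?thesis
        by (simp add: cond_prob_def nonzero_divide_eq_eq mult.commute)
    next
      \<comment> \<open>The binomial conditional law is available only for loads of positive
        probability. For a null load the joint event is null by monotonicity, so both sides
        vanish.\<close>
      case False
      then have zero: "\<P>(\<omega> in M. V (n - 1) l \<omega> = i) = 0"
        using measure_nonneg[of M "{\<omega> \<in> space M. V (n - 1) l \<omega> = i}"] by linarith
      have "prob (?F i) \<le> \<P>(\<omega> in M. V (n - 1) l \<omega> = i)"
        by (rule finite_measure_mono) (blast, measurable)
      with zero have "prob (?F i) = 0"
        using measure_nonneg[of M "?F i"] by linarith
      with zero show ?thesis by (simp only: mult_zero_left)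
    qed
  qed simp
  finally show ?thesis .
qed

text \<open>Subtraction on \<open>nat\<close> truncates at 0; since at most \<open>C\<close>
  passengers remain, no truncation occurs and \<open>available\<close> determines
  \<open>remaining\<close>.\<close>

lemma prob_available:
  assumes "n \<in> {1..N}" "1 \<le> l" "k \<le> C"
  shows "\<P>(\<omega> in M. available C V alights n l \<omega> = k) =
    \<P>(\<omega> in M. remaining V alights n l \<omega> = C - k)"
proof -
  have "available C V alights n l \<omega> = k \<longleftrightarrow> remaining V alights n l \<omega> = C - k"
    if "\<omega> \<in> space M" for \<omega>
    using remaining_le[OF assms(1,2) that] assms(3) by (auto simp: available_def)
  then show ?thesis by (intro arg_cong[where f = prob]) blast
qed

end

text \<open>Convergence ensures that the \<open>lim\<close> stored in \<open>steady_state\<close> is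
  a genuine limit, and \<open>k \<le> C\<close> keeps the index inside the vector.\<close>

lemma has_steady_stateD:
  assumes "has_steady_state M C X" "k \<le> C"
  shows "(\<lambda>l. \<P>(\<omega> in M. X l \<omega> = k)) \<longlonglongrightarrow> steady_state M C X $ k"
  using assms by (simp add: has_steady_state_def steady_state_def convergent_LIMSEQ_iff)

lemma dim_steady_state [simp]: "dim_vec (steady_state M C X) = C + 1"
  by (simp add: steady_state_def)

theorem proposition1:
  fixes M :: "'w measure"
    and N C :: nat
    and \<alpha> :: "nat \<Rightarrow> real"
    and V :: "nat \<Rightarrow> nat \<Rightarrow> 'w \<Rightarrow> nat"
    and alights :: "nat \<Rightarrow> nat \<Rightarrow> nat \<Rightarrow> 'w \<Rightarrow> bool"
    and n :: nat
    and v g s :: "real vec"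
    and A :: "real mat"
  assumes "transit_route M N C \<alpha> V alights"
    and "n \<in> {1..N}"
    and "has_steady_state M C (V (n - 1))"
    and "has_steady_state M C (remaining V alights n)"
    and "has_steady_state M C (available C V alights n)"
  defines "v \<equiv> steady_state M C (V (n - 1))"
    and "g \<equiv> steady_state M C (remaining V alights n)"
    and "s \<equiv> steady_state M C (available C V alights n)"
    and "A \<equiv> alighting_matrix C (\<alpha> n)"
  shows "mat_of_row g = mat_of_row v * A \<and>
    (\<forall>k\<le>C. s $ k = g $ (C - k)) \<and>
    (\<forall>l\<ge>1. \<forall>i\<le>C. \<forall>j\<le>C. \<P>(\<omega> in M. V (n - 1) l \<omega> = i) > 0 \<longrightarrow>
      \<P>(\<omega> in M. remaining V alights n l \<omega> = j \<bar> V (n - 1) l \<omega> = i) = A $$ (i, j))"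
proof -
  interpret transit_route M N C \<alpha> V alights by fact
  note n = \<open>n \<in> {1..N}\<close>
  have g_eq: "g $ j = (\<Sum>i\<le>C. v $ i * A $$ (i, j))" if j: "j \<le> C" for j
  \<comment> \<open>The same sequence of probabilities converges to \<open>g $ j\<close> by
    definition and to the matrix expression by the identity for each vehicle; the finite sum allows
    termwise limits.\<close>
  proof (rule LIMSEQ_unique)
    show "(\<lambda>l. \<P>(\<omega> in M. remaining V alights n l \<omega> = j)) \<longlonglongrightarrow> g $ j"
      unfolding g_def using assms(4) j by (rule has_steady_stateD)
    have "(\<lambda>l. \<Sum>i\<le>C. \<P>(\<omega> in M. V (n - 1) l \<omega> = i) * A $$ (i, j)) \<longlonglongrightarrow>
        (\<Sum>i\<le>C. v $ i * A $$ (i, j))"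
      unfolding v_def by (intro tendsto_intros has_steady_stateD assms(3)) simp
    then show "(\<lambda>l. \<P>(\<omega> in M. remaining V alights n l \<omega> = j)) \<longlonglongrightarrow>
        (\<Sum>i\<le>C. v $ i * A $$ (i, j))"
      \<comment> \<open>The identity holds from vehicle 1 on; index 0 carries no vehicle, so the two
        sequences are only compared eventually.\<close>
      by (rule Lim_transform_eventually)
        (use prob_remaining[OF n _ j] in \<open>auto simp: eventually_sequentially A_def intro!: exI[of _ 1]\<close>)
  qed
  have "mat_of_row g = mat_of_row v * A"
  proof (rule eq_matI)
    fix r j assume "r < dim_row (mat_of_row v * A)" "j < dim_col (mat_of_row v * A)"
    \<comment> \<open>A row vector is a matrix with a single row, so only row 0 has to be
      checked.\<close>
    then have r: "r = 0" and j: "j < C + 1" by (auto simp: A_def alighting_matrix_def)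
    have "(mat_of_row v * A) $$ (0, j) = (\<Sum>i = 0..<C + 1. v $ i * A $$ (i, j))"
      using j by (simp add: scalar_prod_def A_def alighting_matrix_def v_def)
    also have "{0..<C + 1} = {..C}" by auto
    finally show "mat_of_row g $$ (r, j) = (mat_of_row v * A) $$ (r, j)"
      using g_eq[of j] j r by (simp add: g_def)
  qed (simp_all add: g_def A_def alighting_matrix_def)
  moreover have "s $ k = g $ (C - k)" if k: "k \<le> C" for k
  proof (rule LIMSEQ_unique)
    show "(\<lambda>l. \<P>(\<omega> in M. available C V alights n l \<omega> = k)) \<longlonglongrightarrow> s $ k"
      unfolding s_def using assms(5) k by (rule has_steady_stateD)
    have "(\<lambda>l. \<P>(\<omega> in M. remaining V alights n l \<omega> = C - k)) \<longlonglongrightarrow> g $ (C - k)"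
      unfolding g_def using assms(4) by (rule has_steady_stateD) simp
    then show "(\<lambda>l. \<P>(\<omega> in M. available C V alights n l \<omega> = k)) \<longlonglongrightarrow> g $ (C - k)"
      by (rule Lim_transform_eventually)
        (use prob_available[OF n _ k] in \<open>auto simp: eventually_sequentially intro!: exI[of _ 1]\<close>)
  qed
  \<comment> \<open>The interpretation of the entries of \<open>A\<close> concerns each individual
    vehicle, so it comes directly from the conditional law, without a limit.\<close>
  ultimately show ?thesis
    using cond_prob_remaining[OF n] by (auto simp: A_def)
qed

end
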